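(* Let $n\ge 1$ and $n\le p\le m$ be integers, $\delta>0$, $a_1,\dots,a_m\in\mathbb{R}^n$, and for $z\in\mathbb{R}^m$ put $A(z)=\sum_{i=1}^m z_ia_ia_i^\top+\delta I$. Let $g(z):=\sum_{i=1}^m\bigl|(z_i-\tfrac12)^2-\tfrac14\bigr|$ and $f_\kappa(\alpha,\beta,z):=-\alpha\beta+\lambda_{\max}(A(z))$. Consider the problem in the variables $(\alpha,\beta,z)\in\mathbb{R}\times\mathbb{R}\times\mathbb{R}^m$ $$\text{(Q)}\qquad \min\ \beta\quad\text{s.t.}\quad f_\kappa(\alpha,\beta,z)\le0,\ \ \lambda_{\min}(A(z))\ge\alpha,\ \ \sum_{i=1}^m z_i=p,\ \ g(z)\le0,\ \ 0\le z_i\le1\ (i=1,\dots,m),\ \ \alpha,\beta\ge\delta.$$ Let $\overline{\lambda}_{\min}$ be an upper bound for $\lambda_{\min}(A(z))$ over all $z\in\{0,1\}^m$ with $\sum_{i=1}^m z_i=p$, set $\eta=\overline{\lambda}_{\min}^2+p$, and for $x=(\alpha,\beta,z_1,\dots,z_m,x_{m+1})\in\mathbb{R}^{m+3}$ set $f_{\mathrm{obj}}(x)=\beta^2+\eta-\|x\|^2$. Consider $$\text{(SL3.2)}\qquad \min_{x\in\mathbb{R}^{m+3}}\ \|x\|^2\quad\text{s.t.}\quad f_\kappa(\alpha,\beta,z)\le0,\ \ f_{\mathrm{obj}}(x)\le0,\ \ \lambda_{\min}(A(z))\ge\alpha,\ \ g(z)\le0,\ \ \sum_{i=1}^m z_i=p,\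 \ 0\le z_i\le1\ (i=1,\dots,m),\ \ \alpha,\beta\ge\delta.$$ Then (Q) can be rewritten as (SL3.2), in the following sense: $(\alpha,\beta,z)$ is a global solution of (Q) if and only if there exists $x_{m+1}\in\mathbb{R}$ such that $(\alpha,\beta,z,x_{m+1})$ is a global solution of (SL3.2).
   Context: $\lambda_{\max}(\cdot)$ and $\lambda_{\min}(\cdot)$ denote the largest and smallest eigenvalue of a symmetric matrix, $\|\cdot\|$ is the Euclidean norm, and $I$ is the $n\times n$ identity matrix. *)

theory Defs
  imports "HOL-Analysis.Analysis"
begin

definition eigenvalues :: "real ^ 'n ^ 'n \<Rightarrow> real set" where
  "eigenvalues M = {c. \<exists>v. v \<noteq> 0 \<and> M *v v = c *\<^sub>R v}"

text \<open>For symmetric matrices the set of (real) eigenvalues is finite and nonempty, so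
  \<open>Max\<close> and \<open>Min\<close> are the genuine extreme eigenvalues; they are only applied to such matrices.\<close>

definition lambda_max :: "real ^ 'n ^ 'n \<Rightarrow> real" where
  "lambda_max M = Max (eigenvalues M)"

definition lambda_min :: "real ^ 'n ^ 'n \<Rightarrow> real" where
  "lambda_min M = Min (eigenvalues M)"

definition outer :: "real ^ 'n \<Rightarrow> real ^ 'n ^ 'n" where
  "outer v = (\<chi> j k. v $ j * v $ k)"

definition A_mat :: "('m::finite \<Rightarrow> real ^ 'n) \<Rightarrow> real \<Rightarrow> real ^ 'm \<Rightarrow> real ^ 'n ^ 'n" where
  "A_mat a \<delta> z = (\<Sum>i\<in>UNIV. z $ i *\<^sub>R outer (a i)) + \<delta> *\<^sub>R mat 1"

definition g_fun :: "real ^ 'm \<Rightarrow> real" where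
  "g_fun z = (\<Sum>i\<in>UNIV. \<bar>(z $ i - 1/2)\<^sup>2 - 1/4\<bar>)"

definition f_kappa ::
  "('m::finite \<Rightarrow> real ^ 'n) \<Rightarrow> real \<Rightarrow> real \<Rightarrow> real \<Rightarrow> real ^ 'm \<Rightarrow> real" where
  "f_kappa a \<delta> \<alpha> \<beta> z = - \<alpha> * \<beta> + lambda_max (A_mat a \<delta> z)"

definition feasible_Q ::
  "('m::finite \<Rightarrow> real ^ 'n) \<Rightarrow> real \<Rightarrow> nat \<Rightarrow> real \<times> real \<times> (real ^ 'm) \<Rightarrow> bool" where
  "feasible_Q a \<delta> p = (\<lambda>(\<alpha>, \<beta>, z).
     f_kappa a \<delta> \<alpha> \<beta> z \<le> 0 \<and> lambda_min (A_mat a \<delta> z) \<ge> \<alpha> \<and>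
     (\<Sum>i\<in>UNIV. z $ i) = real p \<and> g_fun z \<le> 0 \<and>
     (\<forall>i. 0 \<le> z $ i \<and> z $ i \<le> 1) \<and> \<alpha> \<ge> \<delta> \<and> \<beta> \<ge> \<delta>)"

definition global_solution_Q ::
  "('m::finite \<Rightarrow> real ^ 'n) \<Rightarrow> real \<Rightarrow> nat \<Rightarrow> real \<times> real \<times> (real ^ 'm) \<Rightarrow> bool" where
  "global_solution_Q a \<delta> p = is_arg_min (\<lambda>(\<alpha>, \<beta>, z). \<beta>) (feasible_Q a \<delta> p)"

text \<open>The space \<open>\<real>\<^sup>m\<^sup>+\<^sup>3\<close> of the points \<open>(\<alpha>, \<beta>, z, x\<^sub>m\<^sub>+\<^sub>1)\<close> is rendered as a product type;
  the library's norm on products is the Euclidean one, i.e.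
  \<open>\<parallel>(\<alpha>, \<beta>, z, t)\<parallel>\<^sup>2 = \<alpha>\<^sup>2 + \<beta>\<^sup>2 + \<parallel>z\<parallel>\<^sup>2 + t\<^sup>2\<close>.\<close>

type_synonym 'm point = "real \<times> real \<times> (real ^ 'm) \<times> real"

definition f_obj :: "real \<Rightarrow> 'm::finite point \<Rightarrow> real" where
  "f_obj \<eta> x = (case x of (\<alpha>, \<beta>, z, t) \<Rightarrow> \<beta>\<^sup>2 + \<eta> - (norm x)\<^sup>2)"

definition feasible_SL ::
  "('m::finite \<Rightarrow> real ^ 'n) \<Rightarrow> real \<Rightarrow> nat \<Rightarrow> real \<Rightarrow> 'm point \<Rightarrow> bool" where
  "feasible_SL a \<delta> p \<eta> = (\<lambda>(\<alpha>, \<beta>, z, t).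
     f_kappa a \<delta> \<alpha> \<beta> z \<le> 0 \<and> f_obj \<eta> (\<alpha>, \<beta>, z, t) \<le> 0 \<and>
     lambda_min (A_mat a \<delta> z) \<ge> \<alpha> \<and> g_fun z \<le> 0 \<and>
     (\<Sum>i\<in>UNIV. z $ i) = real p \<and>
     (\<forall>i. 0 \<le> z $ i \<and> z $ i \<le> 1) \<and> \<alpha> \<ge> \<delta> \<and> \<beta> \<ge> \<delta>)"

definition global_solution_SL ::
  "('m::finite \<Rightarrow> real ^ 'n) \<Rightarrow> real \<Rightarrow> nat \<Rightarrow> real \<Rightarrow> 'm point \<Rightarrow> bool" where
  "global_solution_SL a \<delta> p \<eta> = is_arg_min (\<lambda>x. (norm x)\<^sup>2) (feasible_SL a \<delta> p \<eta>)"

end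

(* Since z is binary with p ones, |z|^2 = p, so f_obj <= 0 says that |x|^2 >= beta^2 + eta.
   As 0 < alpha <= lmin_bar, the slack variable x_{m+1} can be chosen with
   x_{m+1}^2 = lmin_bar^2 - alpha^2, which turns this into an equality. Hence the least value
   of |x|^2 over the slack variable is beta^2 + eta, and minimising it amounts to
   minimising beta > 0. *)
theory Submission
  imports Defs
begin

text \<open>Each summand equals |z_i (z_i - 1)|, and a sum of nonnegative terms is at most 0 only if
  every term vanishes. Thus the continuous constraint on \<open>g_fun\<close> encodes integrality of
  \<open>z\<close>.\<close>

lemma g_fun_nonpos_iff:
  fixes z :: "real ^ 'm::finite"
  shows "g_fun z \<le> 0 \<longleftrightarrow> (\<forall>i. z $ i \<in> {0, 1})"
proof -
  have "g_fun z \<le> 0 \<longleftrightarrow> g_fun z = 0"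
    unfolding g_fun_def by (simp add: order_antisym_conv sum_nonneg)
  also have "\<dots> \<longleftrightarrow> (\<forall>i. (z $ i - 1/2)\<^sup>2 - 1/4 = 0)"
    unfolding g_fun_def by (simp add: sum_nonneg_eq_0_iff)
  also have "\<dots> \<longleftrightarrow> (\<forall>i. z $ i * (z $ i - 1) = 0)"
    by (simp add: power2_eq_square field_simps)
  finally show ?thesis
    by auto
qed

text \<open>The numbers 0 and 1 are their own squares, so the squared norm just counts the ones;
  under the cardinality constraint it is the constant \<open>p\<close>.\<close>

lemma norm_power2_binary:
  fixes z :: "real ^ 'm::finite"
  assumes "\<forall>i. z $ i \<in> {0, 1}"
  shows "(norm z)\<^sup>2 = (\<Sum>i\<in>UNIV. z $ i)"
proof -
  have "(z $ i)\<^sup>2 = z $ i" for i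
    using assms[rule_format, of i] by auto
  then show ?thesis
    unfolding power2_norm_eq_inner inner_vec_def by (simp flip: power2_eq_square)
qed

lemma norm_point_power2:
  "(norm (\<alpha>, \<beta>, z, t))\<^sup>2 = \<alpha>\<^sup>2 + \<beta>\<^sup>2 + (norm z)\<^sup>2 + t\<^sup>2"
  for \<alpha> \<beta> t :: real and z :: "'a::real_normed_vector"
  by (simp add: norm_Pair)

text \<open>Isolates the only constraint that involves the slack \<open>t\<close>: a lower bound on
  the very quantity that the second problem minimises.\<close>

lemma feasible_SL_iff:
  "feasible_SL a \<delta> p \<eta> (\<alpha>, \<beta>, z, t) \<longleftrightarrow>
     feasible_Q a \<delta> p (\<alpha>, \<beta>, z) \<and> \<beta>\<^sup>2 + \<eta> \<le> (norm (\<alpha>, \<beta>, z, t))\<^sup>2"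
  unfolding feasible_SL_def feasible_Q_def f_obj_def by auto

lemma feasible_SL_tight:
  assumes "\<delta> > 0"
    and bound: "\<And>w :: real ^ 'm::finite. (\<forall>i. w $ i \<in> {0, 1}) \<Longrightarrow> (\<Sum>i\<in>UNIV. w $ i) = real p \<Longrightarrow>
           lambda_min (A_mat a \<delta> w) \<le> l"
    and feas: "feasible_Q a \<delta> p (\<alpha>, \<beta>, z)"
  obtains t where "feasible_SL a \<delta> p (l\<^sup>2 + real p) (\<alpha>, \<beta>, z, t)"
    and "(norm (\<alpha>, \<beta>, z, t))\<^sup>2 = \<beta>\<^sup>2 + (l\<^sup>2 + real p)"
proof -
  have z: "\<forall>i. z $ i \<in> {0, 1}" "(\<Sum>i\<in>UNIV. z $ i) = real p"
    and \<alpha>: "\<delta> \<le> \<alpha>" "\<alpha> \<le> lambda_min (A_mat a \<delta> z)"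
    using feas unfolding feasible_Q_def g_fun_nonpos_iff by auto
  \<comment> \<open>The bound \<open>l\<close> applies to \<open>z\<close> because feasibility makes
    \<open>z\<close> binary with sum \<open>p\<close>. The sign of \<alpha> is recorded because the
    inequality is squared next.\<close>
  have "0 \<le> \<alpha>" "\<alpha> \<le> l"
    using \<alpha> \<open>\<delta> > 0\<close> bound[OF z] by linarith+
  then have "\<alpha>\<^sup>2 \<le> l\<^sup>2"
    by (rule power_mono[rotated])
  \<comment> \<open>The radicand is nonnegative by the previous step, so the squared slack cancels
    \<alpha>^2 and leaves l^2, while \<open>z\<close> contributes \<open>p\<close>.\<close>
  then have "(norm (\<alpha>, \<beta>, z, sqrt (l\<^sup>2 - \<alpha>\<^sup>2)))\<^sup>2 = \<beta>\<^sup>2 + (l\<^sup>2 + real p)"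
    using z by (simp add: norm_point_power2 norm_power2_binary)
  then show thesis
    using that feas by (simp add: feasible_SL_iff)
qed

theorem lemma5p4:
  fixes a :: "'m::finite \<Rightarrow> real ^ 'n"
    and \<delta> lmin_bar \<eta> \<alpha> \<beta> :: real
    and p :: nat
    and z :: "real ^ 'm"
  assumes "CARD('n) \<le> p" and "p \<le> CARD('m)"
    and "\<delta> > 0"
    and "\<And>w :: real ^ 'm. (\<forall>i. w $ i \<in> {0, 1}) \<Longrightarrow> (\<Sum>i\<in>UNIV. w $ i) = real p \<Longrightarrow>
           lambda_min (A_mat a \<delta> w) \<le> lmin_bar"
    and "\<eta> = lmin_bar\<^sup>2 + real p"
  shows "global_solution_Q a \<delta> p (\<alpha>, \<beta>, z) \<longleftrightarrow>
         (\<exists>t. global_solution_SL a \<delta> p \<eta> (\<alpha>, \<beta>, z, t))"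
proof
  have tight: "\<exists>t. feasible_SL a \<delta> p \<eta> (\<alpha>', \<beta>', z', t) \<and> (norm (\<alpha>', \<beta>', z', t))\<^sup>2 = \<beta>'\<^sup>2 + \<eta>"
    if "feasible_Q a \<delta> p (\<alpha>', \<beta>', z')" for \<alpha>' \<beta>' z'
  proof (rule feasible_SL_tight[where l = lmin_bar, OF \<open>\<delta> > 0\<close> _ that])
    show "lambda_min (A_mat a \<delta> w) \<le> lmin_bar"
      if "\<forall>i. w $ i \<in> {0, 1}" "(\<Sum>i\<in>UNIV. w $ i) = real p" for w
      using that by (rule assms(4))
  qed (use \<open>\<eta> = _\<close> in blast)
  have pos: "0 < \<beta>'" if "feasible_Q a \<delta> p (\<alpha>', \<beta>', z')" for \<alpha>' \<beta>' z'
    using that \<open>\<delta> > 0\<close> unfolding feasible_Q_def by auto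
  {
    assume "global_solution_Q a \<delta> p (\<alpha>, \<beta>, z)"
    then have feas: "feasible_Q a \<delta> p (\<alpha>, \<beta>, z)"
      and min: "\<And>\<alpha>' \<beta>' z'. feasible_Q a \<delta> p (\<alpha>', \<beta>', z') \<Longrightarrow> \<beta> \<le> \<beta>'"
      unfolding global_solution_Q_def is_arg_min_linorder by auto
    obtain t where t: "feasible_SL a \<delta> p \<eta> (\<alpha>, \<beta>, z, t)" "(norm (\<alpha>, \<beta>, z, t))\<^sup>2 = \<beta>\<^sup>2 + \<eta>"
      using tight[OF feas] by blast
    have "(norm (\<alpha>, \<beta>, z, t))\<^sup>2 \<le> (norm (\<alpha>', \<beta>', z', t'))\<^sup>2"
      if "feasible_SL a \<delta> p \<eta> (\<alpha>', \<beta>', z', t')" for \<alpha>' \<beta>' z' t'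
    proof -
      \<comment> \<open>Optimality of \<beta> survives squaring since \<beta> > 0. The tight lift
        has value \<beta>^2 + \<eta>, and any competitor has at least \<beta>'^2 + \<eta>.\<close>
      have "\<beta>\<^sup>2 \<le> \<beta>'\<^sup>2"
        using that min pos[OF feas] by (intro power_mono) (auto simp: feasible_SL_iff)
      then show ?thesis
        using that t(2) unfolding feasible_SL_iff by linarith
    qed
    then show "\<exists>t. global_solution_SL a \<delta> p \<eta> (\<alpha>, \<beta>, z, t)"
      unfolding global_solution_SL_def is_arg_min_linorder using t(1) by auto
  next
    assume "\<exists>t. global_solution_SL a \<delta> p \<eta> (\<alpha>, \<beta>, z, t)"
    then obtain t where feas: "feasible_SL a \<delta> p \<eta> (\<alpha>, \<beta>, z, t)"
      and min: "\<And>x. feasible_SL a \<delta> p \<eta> x \<Longrightarrow> (norm (\<alpha>, \<beta>, z, t))\<^sup>2 \<le> (norm x)\<^sup>2"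
      unfolding global_solution_SL_def is_arg_min_linorder by blast
    have "\<beta> \<le> \<beta>'" if feas': "feasible_Q a \<delta> p (\<alpha>', \<beta>', z')" for \<alpha>' \<beta>' z'
    proof -
      obtain t' where t': "feasible_SL a \<delta> p \<eta> (\<alpha>', \<beta>', z', t')"
        and norm_t': "(norm (\<alpha>', \<beta>', z', t'))\<^sup>2 = \<beta>'\<^sup>2 + \<eta>"
        using tight[OF feas'] by blast
      \<comment> \<open>The given \<open>t\<close> is not known to be tight; feasibility supplies
        the lower bound, and the tight lift of the competitor supplies the upper one.\<close>
      have "\<beta>\<^sup>2 + \<eta> \<le> (norm (\<alpha>, \<beta>, z, t))\<^sup>2"
        using feas by (simp add: feasible_SL_iff)
      also have "\<dots> \<le> \<beta>'\<^sup>2 + \<eta>"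
        using min[OF t'] unfolding norm_t' .
      finally have "\<beta>\<^sup>2 \<le> \<beta>'\<^sup>2"
        by simp
      then show ?thesis
        \<comment> \<open>Cancelling the squares takes only the nonnegativity of the larger side
          \<beta>'.\<close>
        using less_imp_le[OF pos[OF feas']] by (rule power2_le_imp_le)
    qed
    moreover have "feasible_Q a \<delta> p (\<alpha>, \<beta>, z)"
      using feas by (simp add: feasible_SL_iff)
    ultimately show "global_solution_Q a \<delta> p (\<alpha>, \<beta>, z)"
      unfolding global_solution_Q_def is_arg_min_linorder by auto
  }
qed

end
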